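(* Let $G$ and $H$ be finite simple graphs. If $G\in\mathfrak{F}$ and $H$ is a Roman graph, then $G\boxtimes H$ is a Roman graph.
   Context: $\gamma(X)$ denotes the domination number of a graph $X$ (minimum size of a set $D$ such that every vertex outside $D$ has a neighbor in $D$). A Roman dominating function on $X$ is a map $f:V(X)\to\{0,1,2\}$ such that every vertex $v$ with $f(v)=0$ has a neighbor $u$ with $f(u)=2$; $\gamma_R(X)$ is the minimum of $\sum_v f(v)$ over such $f$. A graph $X$ is Roman if $\gamma_R(X)=2\gamma(X)$. $\mathfrak{F}$ is the class of graphs $G$ having a dominating set $S=\{u_1,\dots,u_{\gamma(G)}\}$ of size $\gamma(G)$ with $N[u_i]\cap N[u_j]=\emptyset$ for all $i\ne j$, where $N[u]$ is the closed neighborhood of $u$. The strong product $G\boxtimes H$ has vertex set $V(G)\times V(H)$, with distinct $(g,h),(g',h')$ adjacent iff ($g=g'$ and $h\sim h'$) or ($g\sim g'$ and $h=h'$) or ($g\sim g'$ and $h\sim h'$). *)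

theory Defs
  imports "Graph_Theory.Graph_Theory"
begin

(* Finite simple graphs are the structures G with "pair_graph G": finite, loopless, symmetric
   digraphs whose arcs are pairs of vertices. An undirected edge {u, v} is represented by the two
   arcs (u, v) and (v, u). *)

definition closed_nbh :: "'a pair_pre_digraph \<Rightarrow> 'a \<Rightarrow> 'a set" where
  "closed_nbh G u = insert u {v. (u, v) \<in> parcs G}"

definition dominating_set :: "'a pair_pre_digraph \<Rightarrow> 'a set \<Rightarrow> bool" where
  "dominating_set G D \<longleftrightarrow>
     D \<subseteq> pverts G \<and> (\<forall>v \<in> pverts G - D. \<exists>u \<in> D. (v, u) \<in> parcs G)"

(* For a finite graph the whole vertex set is dominating, so the minimum is attained; likewise
   below, where the constant function 2 is Roman dominating. *)
definition domination_number :: "'a pair_pre_digraph \<Rightarrow> nat" where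
  "domination_number G = (LEAST n. \<exists>D. dominating_set G D \<and> card D = n)"

(* The values of f outside the vertex set are unconstrained and do not affect the weight. *)
definition roman_dominating_function :: "'a pair_pre_digraph \<Rightarrow> ('a \<Rightarrow> nat) \<Rightarrow> bool" where
  "roman_dominating_function G f \<longleftrightarrow>
     (\<forall>v \<in> pverts G. f v \<in> {0, 1, 2}) \<and>
     (\<forall>v \<in> pverts G. f v = 0 \<longrightarrow> (\<exists>u \<in> pverts G. (v, u) \<in> parcs G \<and> f u = 2))"

definition roman_domination_number :: "'a pair_pre_digraph \<Rightarrow> nat" where
  "roman_domination_number G =
     (LEAST n. \<exists>f. roman_dominating_function G f \<and> (\<Sum>v \<in> pverts G. f v) = n)"

definition roman_graph :: "'a pair_pre_digraph \<Rightarrow> bool" where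
  "roman_graph G \<longleftrightarrow> roman_domination_number G = 2 * domination_number G"

definition class_F :: "'a pair_pre_digraph set" where
  "class_F = {G. pair_graph G \<and>
     (\<exists>S. dominating_set G S \<and> card S = domination_number G \<and>
        (\<forall>u \<in> S. \<forall>v \<in> S. u \<noteq> v \<longrightarrow> closed_nbh G u \<inter> closed_nbh G v = {}))}"

definition strong_product ::
    "'a pair_pre_digraph \<Rightarrow> 'b pair_pre_digraph \<Rightarrow> ('a \<times> 'b) pair_pre_digraph" where
  "strong_product G H =
     \<lparr> pverts = pverts G \<times> pverts H,
       parcs = {((g, h), (g', h')) | g h g' h'.
         (g, h) \<in> pverts G \<times> pverts H \<and> (g', h') \<in> pverts G \<times> pverts H \<and> (g, h) \<noteq> (g', h') \<and>
         (g = g' \<and> (h, h') \<in> parcs H \<or>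
          (g, g') \<in> parcs G \<and> h = h' \<or>
          (g, g') \<in> parcs G \<and> (h, h') \<in> parcs H)} \<rparr>"

lemma pair_graph_strong_product:
  assumes "pair_graph G" and "pair_graph H"
  shows "pair_graph (strong_product G H)"
proof -
  interpret G: pair_graph G by fact
  interpret H: pair_graph H by fact
  have symG: "\<And>a b. (a, b) \<in> parcs G \<Longrightarrow> (b, a) \<in> parcs G"
    using G.pair_sym_arcs by (auto simp: symmetric_def dest: symD)
  have symH: "\<And>a b. (a, b) \<in> parcs H \<Longrightarrow> (b, a) \<in> parcs H"
    using H.pair_sym_arcs by (auto simp: symmetric_def dest: symD)
  let ?P = "strong_product G H"
  have sub: "parcs ?P \<subseteq> pverts ?P \<times> pverts ?P"
    by (auto simp: strong_product_def)
  have fin: "finite (pverts ?P)"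
    by (simp add: strong_product_def G.pair_finite_verts H.pair_finite_verts)
  show ?thesis
  proof unfold_locales
    show "\<And>e. e \<in> parcs ?P \<Longrightarrow> fst e \<in> pverts ?P"
      and "\<And>e. e \<in> parcs ?P \<Longrightarrow> snd e \<in> pverts ?P"
      using sub by auto
    show "finite (pverts ?P)" by (rule fin)
    show "finite (parcs ?P)" using sub fin by (meson finite_SigmaI finite_subset)
    show "\<And>e. e \<in> parcs ?P \<Longrightarrow> fst e \<noteq> snd e"
      by (auto simp: strong_product_def)
    have "sym (parcs ?P)"
      by (rule symI) (auto simp: strong_product_def intro: symG symH)
    then show "symmetric (with_proj ?P)"
      by (simp add: symmetric_def)
  qed
qed

end

theory Submission
  imports Defs
begin

text \<open>
  Every graph satisfies \<open>\<gamma>\<^sub>R \<le> 2\<gamma>\<close>, and products of dominating sets give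
  \<open>\<gamma>(G \<boxtimes> H) \<le> \<gamma>(G) \<gamma>(H)\<close>. Conversely, let \<open>f\<close> be a Roman dominating function on
  \<open>G \<boxtimes> H\<close>. For each \<open>u\<close>, the map \<open>h \<mapsto> max {f (g, h) | g \<in> N[u]}\<close> is Roman dominating on \<open>H\<close>, so
  \<open>f\<close> has weight at least \<open>\<gamma>\<^sub>R(H)\<close> on \<open>N[u] \<times> V(H)\<close>. Summing over the \<open>\<gamma>(G)\<close> disjoint closed
  neighbourhoods gives \<open>\<gamma>\<^sub>R(G \<boxtimes> H) \<ge> \<gamma>(G) \<gamma>\<^sub>R(H) = 2 \<gamma>(G) \<gamma>(H) \<ge> 2 \<gamma>(G \<boxtimes> H)\<close>.
\<close>

lemma domination_number_le:
  "dominating_set G D \<Longrightarrow> domination_number G \<le> card D"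
  unfolding domination_number_def by (rule Least_le) blast

lemma domination_number_attained:
  obtains D where "dominating_set G D" "card D = domination_number G"
proof -
  have "dominating_set G (pverts G)"
    by (simp add: dominating_set_def)
  then have "\<exists>D. dominating_set G D \<and> card D = domination_number G"
    unfolding domination_number_def
    by (intro LeastI_ex[where P = "\<lambda>n. \<exists>D. dominating_set G D \<and> card D = n"]) blast
  then show thesis
    using that by blast
qed

lemma roman_domination_number_le:
  "roman_dominating_function G f \<Longrightarrow> roman_domination_number G \<le> (\<Sum>v \<in> pverts G. f v)"
  unfolding roman_domination_number_def by (rule Least_le) blast

lemma roman_domination_number_attained:
  obtains f where "roman_dominating_function G f"
    "(\<Sum>v \<in> pverts G. f v) = roman_domination_number G"
proof -
  have "roman_dominating_function G (\<lambda>_. 2)"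
    by (simp add: roman_dominating_function_def)
  then have "\<exists>f. roman_dominating_function G f \<and> (\<Sum>v \<in> pverts G. f v) = roman_domination_number G"
    unfolding roman_domination_number_def
    by (intro LeastI_ex[where P = "\<lambda>n. \<exists>f. roman_dominating_function G f \<and> (\<Sum>v \<in> pverts G. f v) = n"]) blast
  then show thesis
    using that by blast
qed

text \<open>Put weight 2 on a minimum dominating set and 0 elsewhere: each vertex of value 0 then
  has a neighbour of value 2.\<close>

lemma roman_domination_number_le_twice_domination_number:
  assumes "finite (pverts G)"
  shows "roman_domination_number G \<le> 2 * domination_number G"
proof -
  obtain D where D: "dominating_set G D" "card D = domination_number G"
    by (rule domination_number_attained)
  let ?f = "\<lambda>v. if v \<in> D then 2 else 0 :: nat"
  have "D \<subseteq> pverts G"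
    using D(1) by (simp add: dominating_set_def)
  have "roman_dominating_function G ?f"
    using D(1) by (force simp: dominating_set_def roman_dominating_function_def)
  then have "roman_domination_number G \<le> (\<Sum>v \<in> pverts G. ?f v)"
    by (rule roman_domination_number_le)
  also have "\<dots> = 2 * card D"
    using assms \<open>D \<subseteq> pverts G\<close> by (simp add: sum.If_cases Int_absorb1)
  finally show ?thesis
    using D(2) by simp
qed

text \<open>Each coordinate is dominated separately, by staying put or by moving along one edge. The
  strong product has an edge for every such combination except staying put in both, and that case is
  excluded for a vertex outside \<open>C \<times> D\<close>.\<close>

lemma dominating_set_strong_product:
  assumes "dominating_set G C" and "dominating_set H D"
  shows "dominating_set (strong_product G H) (C \<times> D)"
  unfolding dominating_set_def
proof (intro conjI ballI)
  show "C \<times> D \<subseteq> pverts (strong_product G H)"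
    using assms by (auto simp: dominating_set_def strong_product_def)
next
  fix v assume v: "v \<in> pverts (strong_product G H) - C \<times> D"
  obtain g h where gh: "v = (g, h)" "g \<in> pverts G" "h \<in> pverts H"
    using v by (auto simp: strong_product_def)
  obtain c where c: "c \<in> C" "g = c \<or> (g, c) \<in> parcs G"
    using assms(1) gh(2) unfolding dominating_set_def by blast
  obtain d where d: "d \<in> D" "h = d \<or> (h, d) \<in> parcs H"
    using assms(2) gh(3) unfolding dominating_set_def by blast
  have "(c, d) \<in> pverts G \<times> pverts H"
    using assms c d by (auto simp: dominating_set_def)
  moreover have "(g, h) \<noteq> (c, d)"
    using v gh c d by auto
  ultimately have "(v, (c, d)) \<in> parcs (strong_product G H)"
    using gh c d by (auto simp: strong_product_def)
  then show "\<exists>u \<in> C \<times> D. (v, u) \<in> parcs (strong_product G H)"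
    using c d by blast
qed

lemma domination_number_strong_product_le:
  "domination_number (strong_product G H) \<le> domination_number G * domination_number H"
proof -
  obtain C where C: "dominating_set G C" "card C = domination_number G"
    by (rule domination_number_attained)
  obtain D where D: "dominating_set H D" "card D = domination_number H"
    by (rule domination_number_attained)
  show ?thesis
    using domination_number_le[OF dominating_set_strong_product[OF C(1) D(1)]] C(2) D(2)
    by (simp add: card_cartesian_product)
qed

lemma (in pair_graph) closed_nbh_subset:
  "u \<in> pverts G \<Longrightarrow> closed_nbh G u \<subseteq> pverts G"
  using in_arcsD2 by (auto simp: closed_nbh_def)

lemma roman_domination_number_le_weight_closed_nbh:
  assumes "pair_graph G" and u: "u \<in> pverts G"
    and f: "roman_dominating_function (strong_product G H) f"
  shows "roman_domination_number H \<le> (\<Sum>g \<in> closed_nbh G u. \<Sum>h \<in> pverts H. f (g, h))"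
proof -
  interpret pair_graph G by fact
  let ?N = "closed_nbh G u"
  \<comment> \<open>The maximum, unlike the sum, keeps the values in {0, 1, 2}, as a Roman
    dominating function requires.\<close>
  define m where "m h = Max ((\<lambda>g. f (g, h)) ` ?N)" for h
  have sub: "?N \<subseteq> pverts G"
    using u by (rule closed_nbh_subset)
  then have fin: "finite ?N"
    using pair_finite_verts finite_subset by blast
  \<comment> \<open>This makes \<open>?N\<close> nonempty, so each \<open>Max\<close> is an attained
    value of \<open>f\<close>.\<close>
  have uN: "u \<in> ?N"
    by (simp add: closed_nbh_def)
  have m_ge: "f (g, h) \<le> m h" if "g \<in> ?N" for g h
    unfolding m_def using fin that by (intro Max_ge) auto
  have m_in: "m h \<in> (\<lambda>g. f (g, h)) ` ?N" for h
    unfolding m_def using fin uN by (intro Max_in) auto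
  have val: "f (g, h) \<in> {0, 1, 2}" if "g \<in> ?N" "h \<in> pverts H" for g h
  proof -
    have "(g, h) \<in> pverts (strong_product G H)"
      using that sub by (auto simp: strong_product_def)
    then show ?thesis
      using f unfolding roman_dominating_function_def by blast
  qed
  have m_val: "m h \<in> {0, 1, 2}" if "h \<in> pverts H" for h
    using m_in[of h] val[OF _ that] by fastforce
  have "roman_dominating_function H m"
    unfolding roman_dominating_function_def
  proof (intro conjI ballI impI m_val)
    fix h assume h: "h \<in> pverts H" and m0: "m h = 0"
    \<comment> \<open>The centre \<open>u\<close> is the right vertex to examine: all neighbours of
      \<open>(u, h)\<close> have first coordinate in \<open>?N\<close>, so the neighbour of value 2
      is seen by \<open>m\<close>.\<close>
    have "f (u, h) = 0"
      using m_ge[OF uN, of h] m0 by simp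
    moreover have "(u, h) \<in> pverts (strong_product G H)"
      using u h by (simp add: strong_product_def)
    ultimately obtain g' h' where *: "((u, h), (g', h')) \<in> parcs (strong_product G H)" "f (g', h') = 2"
      using f unfolding roman_dominating_function_def by (metis surj_pair)
    have g': "g' \<in> ?N" and h': "h' \<in> pverts H" and "h' = h \<or> (h, h') \<in> parcs H"
      using *(1) by (auto simp: strong_product_def closed_nbh_def)
    \<comment> \<open>Otherwise the value 2 would occur among the values over \<open>h\<close>,
      whose maximum is 0. Hence \<open>h'\<close> is a genuine neighbour of \<open>h\<close> in
      \<open>H\<close>.\<close>
    moreover have "h' \<noteq> h"
      using m_ge[OF g', of h] m0 *(2) by auto
    moreover have "m h' = 2"
      using m_ge[OF g', of h'] *(2) m_val[OF h'] by auto
    ultimately show "\<exists>h' \<in> pverts H. (h, h') \<in> parcs H \<and> m h' = 2"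
      by blast
  qed
  then have "roman_domination_number H \<le> (\<Sum>h \<in> pverts H. m h)"
    by (rule roman_domination_number_le)
  \<comment> \<open>The maximum is one of the summands, and the others are nonnegative.\<close>
  also have "\<dots> \<le> (\<Sum>h \<in> pverts H. \<Sum>g \<in> ?N. f (g, h))"
  proof (rule sum_mono)
    fix h
    obtain g where "g \<in> ?N" "m h = f (g, h)"
      using m_in[of h] by auto
    then show "m h \<le> (\<Sum>g \<in> ?N. f (g, h))"
      using fin member_le_sum[of g ?N "\<lambda>g. f (g, h)"] by simp
  qed
  also have "\<dots> = (\<Sum>g \<in> ?N. \<Sum>h \<in> pverts H. f (g, h))"
    by (rule sum.swap)
  finally show ?thesis .
qed

lemma roman_domination_number_strong_product_ge:
  assumes G: "pair_graph G" and S: "S \<subseteq> pverts G"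
    and disj: "\<forall>u \<in> S. \<forall>v \<in> S. u \<noteq> v \<longrightarrow> closed_nbh G u \<inter> closed_nbh G v = {}"
  shows "card S * roman_domination_number H \<le> roman_domination_number (strong_product G H)"
proof -
  interpret pair_graph G by fact
  obtain f where f: "roman_dominating_function (strong_product G H) f"
    "(\<Sum>v \<in> pverts (strong_product G H). f v) = roman_domination_number (strong_product G H)"
    by (rule roman_domination_number_attained)
  let ?w = "\<lambda>g. \<Sum>h \<in> pverts H. f (g, h)"
  have fin: "finite S"
    using S pair_finite_verts finite_subset by blast
  have sub: "closed_nbh G u \<subseteq> pverts G" if "u \<in> S" for u
    using that S closed_nbh_subset by blast
  have "card S * roman_domination_number H = (\<Sum>u \<in> S. roman_domination_number H)"
    by simp
  also have "\<dots> \<le> (\<Sum>u \<in> S. \<Sum>g \<in> closed_nbh G u. ?w g)"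
    using S by (intro sum_mono roman_domination_number_le_weight_closed_nbh G f(1)) auto
  \<comment> \<open>Disjointness of the closed neighbourhoods ensures that no weight is counted
    twice.\<close>
  also have "\<dots> = (\<Sum>g \<in> (\<Union>u \<in> S. closed_nbh G u). ?w g)"
    using fin disj finite_subset[OF sub pair_finite_verts]
    by (intro sum.UNION_disjoint[symmetric]) auto
  also have "\<dots> \<le> (\<Sum>g \<in> pverts G. ?w g)"
    using sub pair_finite_verts by (intro sum_mono2) auto
  also have "\<dots> = (\<Sum>v \<in> pverts (strong_product G H). f v)"
    by (simp add: strong_product_def sum.cartesian_product)
  finally show ?thesis
    using f(2) by simp
qed

theorem theorem27:
  fixes G :: "'a pair_pre_digraph" and H :: "'b pair_pre_digraph"
  assumes "pair_graph G" and "pair_graph H"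
    and "G \<in> class_F"
    and "roman_graph H"
  shows "roman_graph (strong_product G H)"
proof -
  interpret P: pair_graph "strong_product G H"
    using assms(1,2) by (rule pair_graph_strong_product)
  obtain S where S: "dominating_set G S" "card S = domination_number G"
    "\<forall>u \<in> S. \<forall>v \<in> S. u \<noteq> v \<longrightarrow> closed_nbh G u \<inter> closed_nbh G v = {}"
    using assms(3) by (auto simp: class_F_def)
  have "2 * domination_number (strong_product G H) \<le> 2 * (domination_number G * domination_number H)"
    using domination_number_strong_product_le by simp
  \<comment> \<open>Here \<open>H\<close> being Roman turns twice its domination number into its
    Roman domination number.\<close>
  also have "\<dots> = card S * roman_domination_number H"
    using S(2) assms(4) by (simp add: roman_graph_def)
  also have "\<dots> \<le> roman_domination_number (strong_product G H)"
    using assms(1) S by (intro roman_domination_number_strong_product_ge) (auto simp: dominating_set_def)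
  \<comment> \<open>This is one inequality of the required equality; the general upper bound
    supplies the other.\<close>
  finally show ?thesis
    using roman_domination_number_le_twice_domination_number[OF P.pair_finite_verts]
    by (simp add: roman_graph_def)
qed

end
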